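(* Let $L$ be a complete multiplicative lattice. Then $\mathrm{Spec}(L)$ is a spectral space whenever the following conditions hold: (a) $L$ is compact; (b) $L$ is algebraic; (c) $L$ has algebraic radicals; (d) if $x$ and $y$ are compact elements in $L$, then there exists a compact $c\in L$ with $\sqrt{c}=\sqrt{xy}$.
   Context: A complete multiplicative lattice is a complete lattice $L$ (smallest element $0$, largest element $1$) equipped with a binary multiplication satisfying $xy\leqslant x\wedge y$ for all $x,y\in L$; nothing else is assumed about the multiplication. An element $p\neq 1$ of $L$ is prime if for all $x,y\in L$, $xy\leqslant p$ implies $x\leqslant p$ or $y\leqslant p$. $\mathrm{Spec}(L)$ is the set of all prime elements of $L$, with the Zariski topology, whose closed sets are exactly the sets $\mathrm{V}(x)=\{p\in\mathrm{Spec}(L)\mid x\leqslant p\}$, $x\in L$. An element of $L$ is radical if it is a meet of a (possibly empty) set of prime elements; $\sqrt{x}$ is the smallest radical element $r$ with $x\leqslant r$. $L$ has algebraic radicals if the closure operator $\sqrt{-}:L\to L$ preserves directed joins. An element $x$ of a complete lattice is compact if every subset $S$ with $x\leqslant\bigvee S$ has a finite subset $F$ with $x\leqslant\bigvee F$; the lattice is compact if its largest element is compact; it is algebraic if every element is a join of compact elements. A spectral space is a compact sober topological space in which the compact open subsets form a basis of the topology that is closed under finite intersections; sober means $\mathrm{T}_0$ and every irreducible closed subset is the closure of a one-element set. *)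

theory Defs
  imports "HOL-Analysis.Analysis"
begin

section \<open>Complete multiplicative lattices\<close>

text \<open>
  The lattice is the whole type; its \<open>0\<close> and \<open>1\<close> are \<open>bot\<close> and \<open>top\<close>, and \<open>*\<close> is an
  arbitrary operation below the meet (not assumed monotone, associative, commutative or unital).
\<close>

class complete_multiplicative_lattice = complete_lattice + times +
  assumes mult_le_inf: "x * y \<le> inf x y"

definition prime_element :: "'a::complete_multiplicative_lattice \<Rightarrow> bool" where
  "prime_element p \<longleftrightarrow> p \<noteq> top \<and> (\<forall>x y. x * y \<le> p \<longrightarrow> x \<le> p \<or> y \<le> p)"

definition Spec :: "'a::complete_multiplicative_lattice set" where
  "Spec = {p. prime_element p}"

definition V :: "'a::complete_multiplicative_lattice \<Rightarrow> 'a set" where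
  "V x = {p \<in> Spec. x \<le> p}"

definition zariski :: "'a::complete_multiplicative_lattice topology" where
  "zariski = topology (\<lambda>U. \<exists>x. U = Spec - V x)"

text \<open>The empty meet is allowed, so \<open>top\<close> is always radical.\<close>

definition radical :: "'a::complete_multiplicative_lattice \<Rightarrow> bool" where
  "radical r \<longleftrightarrow> (\<exists>P \<subseteq> Spec. r = Inf P)"

definition rad :: "'a::complete_multiplicative_lattice \<Rightarrow> 'a" where
  "rad x = (LEAST r. radical r \<and> x \<le> r)"

section \<open>Compactness, algebraicity and directed joins\<close>

definition compact_element :: "'a::complete_lattice \<Rightarrow> bool" where
  "compact_element x \<longleftrightarrow> (\<forall>S. x \<le> Sup S \<longrightarrow> (\<exists>F \<subseteq> S. finite F \<and> x \<le> Sup F))"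

definition compact_lattice :: "'a::complete_lattice itself \<Rightarrow> bool" where
  "compact_lattice _ \<longleftrightarrow> compact_element (top :: 'a)"

definition algebraic_lattice :: "'a::complete_lattice itself \<Rightarrow> bool" where
  "algebraic_lattice _ \<longleftrightarrow> (\<forall>x::'a. \<exists>K. (\<forall>k\<in>K. compact_element k) \<and> x = Sup K)"

definition directed :: "'a::order set \<Rightarrow> bool" where
  "directed D \<longleftrightarrow> D \<noteq> {} \<and> (\<forall>x\<in>D. \<forall>y\<in>D. \<exists>z\<in>D. x \<le> z \<and> y \<le> z)"

definition preserves_directed_joins :: "('a::complete_lattice \<Rightarrow> 'b::complete_lattice) \<Rightarrow> bool" where
  "preserves_directed_joins f \<longleftrightarrow> (\<forall>D. directed D \<longrightarrow> f (Sup D) = Sup (f ` D))"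

definition algebraic_radicals :: "'a::complete_multiplicative_lattice itself \<Rightarrow> bool" where
  "algebraic_radicals _ \<longleftrightarrow> preserves_directed_joins (rad :: 'a \<Rightarrow> 'a)"

section \<open>Spectral spaces\<close>

text \<open>Irreducible sets are nonempty by convention; otherwise no space would be sober.\<close>

definition irreducible_closedin :: "'a topology \<Rightarrow> 'a set \<Rightarrow> bool" where
  "irreducible_closedin X C \<longleftrightarrow> closedin X C \<and> C \<noteq> {} \<and>
     (\<forall>A B. closedin X A \<and> closedin X B \<and> C = A \<union> B \<longrightarrow> C = A \<or> C = B)"

definition sober_space :: "'a topology \<Rightarrow> bool" where
  "sober_space X \<longleftrightarrow> t0_space X \<and>
     (\<forall>C. irreducible_closedin X C \<longrightarrow> (\<exists>x \<in> topspace X. C = X closure_of {x}))"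

definition compact_openin :: "'a topology \<Rightarrow> 'a set \<Rightarrow> bool" where
  "compact_openin X U \<longleftrightarrow> openin X U \<and> compactin X U"

text \<open>\<open>topspace X\<close> is the empty intersection.\<close>

definition spectral_space :: "'a topology \<Rightarrow> bool" where
  "spectral_space X \<longleftrightarrow> compact_space X \<and> sober_space X \<and>
     openin X = arbitrary union_of compact_openin X \<and>
     (\<forall>\<F>. finite \<F> \<and> (\<forall>U\<in>\<F>. compact_openin X U) \<longrightarrow> compact_openin X (topspace X \<inter> \<Inter>\<F>))"

section \<open>The topology and the radical are well defined\<close>

lemma V_mult: "V (x * y) = V x \<union> V y"
proof -
  have "x * y \<le> x" "x * y \<le> y"
    using mult_le_inf[of x y] by auto
  then show ?thesis
    unfolding V_def Spec_def prime_element_def by (auto intro: order_trans)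
qed

lemma V_Sup: "V (Sup S) = {p \<in> Spec. \<forall>x\<in>S. p \<in> V x}"
  by (auto simp: V_def Sup_le_iff)

lemma V_top: "V top = {}"
  by (auto simp: V_def Spec_def prime_element_def top_unique)

lemma V_bot: "V bot = Spec"
  by (auto simp: V_def)

lemma istopology_zariski:
  "istopology (\<lambda>U. \<exists>x::'a::complete_multiplicative_lattice. U = Spec - V x)"
  unfolding istopology_def
proof (intro conjI allI impI)
  fix S T :: "'a set"
  assume "\<exists>x. S = Spec - V x" "\<exists>x. T = Spec - V x"
  then obtain x y where "S = Spec - V x" "T = Spec - V y" by blast
  then have "S \<inter> T = Spec - V (x * y)" by (auto simp: V_mult)
  then show "\<exists>x. S \<inter> T = Spec - V x" by blast
next
  fix \<K> :: "'a set set"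
  assume "\<forall>K\<in>\<K>. \<exists>x. K = Spec - V x"
  then obtain f where f: "\<And>K. K \<in> \<K> \<Longrightarrow> K = Spec - V (f K)" by metis
  have "\<Union>\<K> = Spec - V (Sup (f ` \<K>))"
    unfolding V_Sup using f by blast
  then show "\<exists>x. \<Union>\<K> = Spec - V x" by blast
qed

lemma openin_zariski: "openin zariski U \<longleftrightarrow> (\<exists>x. U = Spec - V x)"
  unfolding zariski_def by (simp add: topology_inverse'[OF istopology_zariski])

lemma topspace_zariski: "topspace zariski = Spec"
proof
  show "topspace zariski \<subseteq> Spec"
    unfolding topspace_def openin_zariski by blast
  have "openin zariski (Spec :: 'a set)"
    unfolding openin_zariski by (rule exI[of _ top]) (simp add: V_top)
  then show "(Spec :: 'a set) \<subseteq> topspace zariski"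
    by (rule openin_subset)
qed

lemma closedin_zariski: "closedin zariski C \<longleftrightarrow> (\<exists>x. C = V x)"
proof -
  have "V x \<subseteq> Spec" for x :: 'a by (auto simp: V_def)
  then show ?thesis
    unfolding closedin_def topspace_zariski openin_zariski
    by (metis Diff_subset double_diff order_refl)
qed

lemma rad_least:
  fixes x :: "'a::complete_multiplicative_lattice"
  shows "radical (rad x)" "x \<le> rad x" "\<And>r. radical r \<Longrightarrow> x \<le> r \<Longrightarrow> rad x \<le> r"
proof -
  have "V x \<subseteq> Spec" by (auto simp: V_def)
  then have "radical (Inf (V x))" unfolding radical_def by (intro exI[of _ "V x"]) simp
  moreover have "x \<le> Inf (V x)" by (rule Inf_greatest) (simp add: V_def)
  ultimately have V: "radical (Inf (V x))" "x \<le> Inf (V x)" by simp_all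
  have least: "Inf (V x) \<le> r" if r: "radical r" "x \<le> r" for r
  proof -
    obtain P where "P \<subseteq> Spec" "r = Inf P" using r(1) by (auto simp: radical_def)
    then have "P \<subseteq> V x" using r(2) by (auto simp: V_def le_Inf_iff)
    then show ?thesis using \<open>r = Inf P\<close> by (simp add: Inf_superset_mono)
  qed
  have "rad x = Inf (V x)"
    unfolding rad_def using V least by (intro Least_equality) auto
  with V least show "radical (rad x)" "x \<le> rad x"
    "\<And>r. radical r \<Longrightarrow> x \<le> r \<Longrightarrow> rad x \<le> r" by auto
qed

end

(* The open sets of Spec L are the complements D(x) of the V(x), and V(x) is contained in V(y)
   exactly when y <= rad x. Sobriety: if V(x) is irreducible, then rad x is prime and is its
   generic point. As rad preserves directed joins, D(k) is compact for every compact element k,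
   because k <= rad (Sup S) is already witnessed by a finite part of S. Algebraicity makes these
   D(k) a basis and shows that they are all the compact open sets. They are closed under binary
   intersections because D(x) and D(y) meet in D(xy) = D(c) for a compact c with the same radical
   as xy, and Spec L = D(1) covers the empty intersection. *)

theory Submission
  imports Defs
begin

text \<open>Any set of primes whose meet is \<open>rad x\<close> consists of primes above
  \<open>x\<close>, so \<open>V x\<close> is the largest such set and has the smallest meet.\<close>

lemma rad_eq_Inf_V: "rad x = Inf (V x)"
proof (rule antisym)
  have "V x \<subseteq> Spec" by (auto simp: V_def)
  then have "radical (Inf (V x))" unfolding radical_def by blast
  moreover have "x \<le> Inf (V x)" by (rule Inf_greatest) (simp add: V_def)
  ultimately show "rad x \<le> Inf (V x)" by (rule rad_least(3))
  obtain P where P: "P \<subseteq> Spec" "rad x = Inf P"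
    using rad_least(1)[of x] by (auto simp: radical_def)
  then have "P \<subseteq> V x"
    using rad_least(2)[of x] by (auto simp: V_def le_Inf_iff)
  then show "Inf (V x) \<le> rad x" using P by (simp add: Inf_superset_mono)
qed

text \<open>Both sides say that \<open>y\<close> lies below every prime above \<open>x\<close>. This
  translates inclusions and coverings in the spectrum into inequalities in the lattice.\<close>

lemma V_subset_iff: "V x \<subseteq> V y \<longleftrightarrow> y \<le> rad x"
proof
  assume "V x \<subseteq> V y"
  then show "y \<le> rad x"
    unfolding rad_eq_Inf_V by (intro Inf_greatest) (auto simp: V_def)
next
  assume "y \<le> rad x"
  then show "V x \<subseteq> V y"
    unfolding rad_eq_Inf_V le_Inf_iff by (auto simp: V_def)
qed

lemma V_rad: "V (rad x) = V x"
proof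
  show "V (rad x) \<subseteq> V x"
    using rad_least(2) order_trans by (fastforce simp: V_def)
  show "V x \<subseteq> V (rad x)" by (simp add: V_subset_iff)
qed

lemma V_sup: "V (sup x y) = V x \<inter> V y"
  by (auto simp: V_def)

lemma rad_mono: "x \<le> y \<Longrightarrow> rad x \<le> rad y"
  by (meson order_trans rad_least)

lemma closure_of_zariski_singleton:
  assumes "p \<in> Spec"
  shows "zariski closure_of {p} = V p"
proof (rule closure_of_unique)
  show "{p} \<subseteq> V p" using assms by (simp add: V_def)
  show "closedin zariski (V p)" by (auto simp: closedin_zariski)
  show "V p \<subseteq> T" if "{p} \<subseteq> T" "closedin zariski T" for T
    using that by (auto simp: closedin_zariski V_def)
qed

lemma t0_space_zariski: "t0_space zariski"
  unfolding t0_space_def topspace_zariski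
proof (intro ballI impI)
  fix p q :: 'a
  assume pq: "p \<in> Spec" "q \<in> Spec" "p \<noteq> q"
  then consider "\<not> p \<le> q" | "\<not> q \<le> p" by fastforce
  then show "\<exists>U. openin zariski U \<and> (p \<notin> U \<longleftrightarrow> q \<in> U)"
  proof cases
    case 1
    \<comment> \<open>The open set \<open>Spec - V p\<close> contains \<open>q\<close> but not
      \<open>p\<close>.\<close>
    then show ?thesis using pq
      by (intro exI[of _ "Spec - V p"]) (auto simp: openin_zariski V_def)
  next
    case 2
    then show ?thesis using pq
      by (intro exI[of _ "Spec - V q"]) (auto simp: openin_zariski V_def)
  qed
qed

lemma prime_element_rad_if_irreducible:
  assumes "irreducible_closedin zariski (V x)"
  shows "prime_element (rad x)"
  unfolding prime_element_def
proof (intro conjI allI impI)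
  from assms have ne: "V x \<noteq> {}"
    and irr: "\<And>A B. closedin zariski A \<Longrightarrow> closedin zariski B \<Longrightarrow> V x = A \<union> B \<Longrightarrow>
      V x = A \<or> V x = B"
    by (auto simp: irreducible_closedin_def)
  \<comment> \<open>Nonemptiness enters here: \<open>rad x = top\<close> would force
    \<open>V x = V top = {}\<close>.\<close>
  show "rad x \<noteq> top" using ne V_rad[of x] V_top by metis
  fix a b
  assume "a * b \<le> rad x"
  then have "V x \<subseteq> V a \<union> V b" by (simp flip: V_mult add: V_subset_iff)
  \<comment> \<open>Irreducibility speaks of a decomposition, not of a covering, so
    \<open>V a\<close> and \<open>V b\<close> are first cut down to \<open>V x\<close> by joining
    with \<open>x\<close>.\<close>
  then have "V x = V (sup x a) \<union> V (sup x b)" by (auto simp: V_sup)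
  then have "V x = V (sup x a) \<or> V x = V (sup x b)"
    by (intro irr) (auto simp: closedin_zariski)
  then have "V x \<subseteq> V a \<or> V x \<subseteq> V b" by (auto simp: V_sup)
  then show "a \<le> rad x \<or> b \<le> rad x" by (simp add: V_subset_iff)
qed

lemma sober_space_zariski: "sober_space zariski"
  unfolding sober_space_def
proof (intro conjI allI impI t0_space_zariski)
  fix C :: "'a set"
  assume C: "irreducible_closedin zariski C"
  then obtain x where x: "C = V x"
    by (auto simp: irreducible_closedin_def closedin_zariski)
  have "rad x \<in> Spec"
    using prime_element_rad_if_irreducible C by (simp add: x Spec_def)
  then show "\<exists>p \<in> topspace zariski. C = zariski closure_of {p}"
    unfolding topspace_zariski x
    by (intro bexI[of _ "rad x"]) (simp_all add: closure_of_zariski_singleton V_rad)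
qed

text \<open>The finite subsets found for the members of \<open>K\<close> have a finite union. This
  later merges a finite subcover into the open set of one compact element.\<close>

lemma compact_element_Sup:
  assumes "finite K" "\<And>k. k \<in> K \<Longrightarrow> compact_element k"
  shows "compact_element (Sup K)"
  unfolding compact_element_def
proof (intro allI impI)
  fix S
  assume "Sup K \<le> Sup S"
  then have "\<forall>k\<in>K. \<exists>F\<subseteq>S. finite F \<and> k \<le> Sup F"
    using assms(2) by (auto simp: Sup_le_iff compact_element_def)
  then obtain F where F: "\<And>k. k \<in> K \<Longrightarrow> F k \<subseteq> S \<and> finite (F k) \<and> k \<le> Sup (F k)"
    by metis
  have "Sup K \<le> Sup (\<Union>(F ` K))"
    using F by (intro Sup_least) (blast intro: order_trans Sup_subset_mono)
  then show "\<exists>F\<subseteq>S. finite F \<and> Sup K \<le> Sup F"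
    using F assms(1) by (intro exI[of _ "\<Union>(F ` K)"]) auto
qed

text \<open>\<open>Sup S\<close> is the directed join of the joins of finite subsets of
  \<open>S\<close>. Since \<open>rad\<close> preserves it, compactness of \<open>k\<close> applies
  to the radicals of these finite joins.\<close>

lemma compact_le_rad_Sup_finite:
  fixes k :: "'a::complete_multiplicative_lattice"
  assumes "algebraic_radicals TYPE('a)" "compact_element k" "k \<le> rad (Sup S)"
  obtains F where "F \<subseteq> S" "finite F" "k \<le> rad (Sup F)"
proof -
  define D where "D = Sup ` {F. F \<subseteq> S \<and> finite F}"
  have "directed D"
    unfolding directed_def
  proof (intro conjI ballI)
    show "D \<noteq> {}" by (auto simp: D_def)
    fix x y
    assume "x \<in> D" "y \<in> D"
    then obtain F G where "F \<subseteq> S" "finite F" "x = Sup F" "G \<subseteq> S" "finite G" "y = Sup G"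
      by (auto simp: D_def)
    then show "\<exists>z\<in>D. x \<le> z \<and> y \<le> z"
      by (intro bexI[of _ "Sup (F \<union> G)"]) (auto simp: D_def Sup_subset_mono)
  qed
  have "Sup S \<le> Sup D"
  proof (rule Sup_least)
    fix s
    assume "s \<in> S"
    then have "Sup {s} \<in> D" unfolding D_def by blast
    then show "s \<le> Sup D" by (auto intro: Sup_upper)
  qed
  then have "k \<le> rad (Sup D)" using assms(3) rad_mono order_trans by blast
  moreover have "rad (Sup D) = Sup (rad ` D)"
    using assms(1) \<open>directed D\<close>
    by (simp add: algebraic_radicals_def preserves_directed_joins_def)
  ultimately have "k \<le> Sup (rad ` D)" by simp
  then obtain R where "R \<subseteq> rad ` D" "finite R" and kR: "k \<le> Sup R"
    using assms(2) by (auto simp: compact_element_def)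
  then obtain \<F> where \<F>: "\<F> \<subseteq> {F. F \<subseteq> S \<and> finite F}" "finite \<F>"
    and R: "R = (\<lambda>F. rad (Sup F)) ` \<F>"
    using finite_subset_image[of R "\<lambda>F. rad (Sup F)" "{F. F \<subseteq> S \<and> finite F}"]
    unfolding D_def image_image by blast
  \<comment> \<open>Finitely many finite subsets of \<open>S\<close> remain; by monotonicity of
    \<open>rad\<close>, their union serves as the single finite witness.\<close>
  have "Sup R \<le> rad (Sup (\<Union>\<F>))"
    unfolding R by (intro SUP_least rad_mono Sup_subset_mono) auto
  with kR have "k \<le> rad (Sup (\<Union>\<F>))" by (rule order_trans)
  with \<F> show thesis by (intro that[of "\<Union>\<F>"]) auto
qed

lemma Spec_diff_V_Sup: "Spec - V (Sup S) = (\<Union>x\<in>S. Spec - V x)"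
  by (auto simp: V_Sup)

lemma compact_openin_zariski_if_compact_element:
  fixes k :: "'a::complete_multiplicative_lattice"
  assumes "algebraic_radicals TYPE('a)" "compact_element k"
  shows "compact_openin zariski (Spec - V k)"
  unfolding compact_openin_def compactin_def
proof (intro conjI allI impI; (elim conjE)?)
  show "openin zariski (Spec - V k)" by (auto simp: openin_zariski)
  show "Spec - V k \<subseteq> topspace zariski" by (auto simp: topspace_zariski)
  fix \<U> :: "'a set set"
  assume \<U>: "\<forall>U\<in>\<U>. openin zariski U" "Spec - V k \<subseteq> \<Union>\<U>"
  \<comment> \<open>Different elements may define the same open set; taking all of them avoids
    choosing representatives.\<close>
  define S where "S = {x. Spec - V x \<in> \<U>}"
  have "Spec - V k \<subseteq> Spec - V (Sup S)"
  proof
    fix p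
    assume "p \<in> Spec - V k"
    then obtain U where "U \<in> \<U>" "p \<in> U" using \<U>(2) by blast
    moreover then obtain x where "U = Spec - V x" using \<U>(1) by (auto simp: openin_zariski)
    ultimately show "p \<in> Spec - V (Sup S)"
      unfolding Spec_diff_V_Sup S_def by blast
  qed
  \<comment> \<open>The covering thus becomes the inequality
    \<open>k \<le> rad (Sup S)\<close>.\<close>
  then have "V (Sup S) \<subseteq> V k" by (auto simp: V_def)
  then obtain F where F: "F \<subseteq> S" "finite F" "k \<le> rad (Sup F)"
    using compact_le_rad_Sup_finite[OF assms] by (auto simp: V_subset_iff)
  have "Spec - V k \<subseteq> Spec - V (Sup F)"
    using F(3) by (auto simp flip: V_subset_iff)
  then show "\<exists>\<F>. finite \<F> \<and> \<F> \<subseteq> \<U> \<and> Spec - V k \<subseteq> \<Union>\<F>"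
    using F(1,2) unfolding Spec_diff_V_Sup S_def
    by (intro exI[of _ "(\<lambda>x. Spec - V x) ` F"]) auto
qed

text \<open>Algebraicity writes \<open>U\<close> as a union of sets \<open>Spec - V k\<close> with
  \<open>k\<close> compact. Finitely many suffice, and the join of their elements is again
  compact.\<close>

lemma compact_openin_zariski_imp_compact_element:
  fixes U :: "'a::complete_multiplicative_lattice set"
  assumes "algebraic_lattice TYPE('a)" "compact_openin zariski U"
  obtains k where "compact_element k" "U = Spec - V k"
proof -
  obtain x where x: "U = Spec - V x"
    using assms(2) by (auto simp: compact_openin_def openin_zariski)
  obtain K where K: "\<And>k. k \<in> K \<Longrightarrow> compact_element k" and "x = Sup K"
    using assms(1) unfolding algebraic_lattice_def by metis
  then have U: "U = \<Union>((\<lambda>k. Spec - V k) ` K)"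
    using x by (simp add: Spec_diff_V_Sup)
  moreover have "\<forall>W\<in>(\<lambda>k. Spec - V k) ` K. openin zariski W"
    by (auto simp: openin_zariski)
  ultimately obtain \<F> where \<F>: "finite \<F>" "\<F> \<subseteq> (\<lambda>k. Spec - V k) ` K" "U \<subseteq> \<Union>\<F>"
    using assms(2) unfolding compact_openin_def compactin_def by (metis subset_refl)
  obtain F where F: "F \<subseteq> K" "finite F" "\<F> = (\<lambda>k. Spec - V k) ` F"
    using finite_subset_image[OF \<F>(1,2)] by blast
  have "U = Spec - V (Sup F)"
    using F(1) \<F>(3) unfolding Spec_diff_V_Sup U F(3) by blast
  moreover have "compact_element (Sup F)"
    using F K by (intro compact_element_Sup) auto
  ultimately show thesis by (rule that[rotated])
qed

theorem theorem4p4: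
  assumes "compact_lattice TYPE('a::complete_multiplicative_lattice)"
    and "algebraic_lattice TYPE('a)"
    and "algebraic_radicals TYPE('a)"
    and "\<And>x y :: 'a. compact_element x \<Longrightarrow> compact_element y \<Longrightarrow>
           \<exists>c. compact_element c \<and> rad c = rad (x * y)"
  shows "spectral_space (zariski :: 'a topology)"
proof -
  let ?X = "zariski :: 'a topology"
  note compact_open = compact_openin_zariski_if_compact_element[OF assms(3)]
  have top: "compact_openin ?X (topspace ?X)"
    using assms(1) compact_open[of top]
    by (simp add: compact_lattice_def V_top topspace_zariski)
  have inter: "compact_openin ?X (U \<inter> W)"
    if "compact_openin ?X U" "compact_openin ?X W" for U W
  proof -
    obtain x where x: "compact_element x" "U = Spec - V x"
      using compact_openin_zariski_imp_compact_element[OF assms(2) \<open>compact_openin ?X U\<close>] .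
    obtain y where y: "compact_element y" "W = Spec - V y"
      using compact_openin_zariski_imp_compact_element[OF assms(2) \<open>compact_openin ?X W\<close>] .
    obtain c where c: "compact_element c" "rad c = rad (x * y)"
      using assms(4) x(1) y(1) by blast
    have "U \<inter> W = Spec - V (x * y)" by (auto simp: x y V_mult)
    \<comment> \<open>\<open>V\<close> depends only on the radical of its argument, so the compact
      \<open>c\<close> can replace the product \<open>x * y\<close>.\<close>
    also have "\<dots> = Spec - V c" by (simp flip: V_rad[of "x * y"] V_rad[of c] add: c(2))
    finally show ?thesis using compact_open c(1) by simp
  qed
  have "compact_openin ?X (topspace ?X \<inter> \<Inter>\<F>)"
    if "finite \<F>" "\<forall>U\<in>\<F>. compact_openin ?X U" for \<F>
    using that
  proof (induction \<F> rule: finite_induct)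
    case empty
    then show ?case using top by simp
  next
    case (insert U \<F>)
    then have "compact_openin ?X (U \<inter> (topspace ?X \<inter> \<Inter>\<F>))" by (simp add: inter)
    then show ?case by (simp only: Inter_insert Int_left_commute)
  qed
  moreover have "openin ?X = arbitrary union_of compact_openin ?X"
  proof (intro ext iffI)
    fix U
    assume "openin ?X U"
    then obtain x where x: "U = Spec - V x" by (auto simp: openin_zariski)
    obtain K where K: "\<And>k. k \<in> K \<Longrightarrow> compact_element k" "x = Sup K"
      using assms(2) unfolding algebraic_lattice_def by metis
    \<comment> \<open>The join \<open>x = Sup K\<close> turns \<open>Spec - V x\<close> into the
      union of the sets \<open>Spec - V k\<close> for \<open>k\<close> in \<open>K\<close>, each of
      which is compact open.\<close>
    show "(arbitrary union_of compact_openin ?X) U"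
      unfolding x K(2) Spec_diff_V_Sup
      using K(1) compact_open
      by (intro arbitrary_union_of_Union union_of_inc) (auto simp: arbitrary_def)
  next
    fix U
    assume "(arbitrary union_of compact_openin ?X) U"
    then show "openin ?X U"
      by (auto simp: union_of_def compact_openin_def intro!: openin_Union)
  qed
  ultimately show ?thesis
    using top sober_space_zariski
    by (simp add: spectral_space_def compact_space_def compact_openin_def)
qed

end
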